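(* Let $G=(V,E,\Gamma)$ be a finite connected simple weighted graph with nonzero edge weights $\gamma_e$, such that for every edge $e$ there is a spanning tree of $G$ not containing $e$, and fix a cycle basis $v_1,\dots,v_c$ and $\omega\in\mathbb{R}^V$. Consider $|W(A)|$ (the $c$-dimensional volume of $W(A)$, with $W$ and $A$ as in the context) as a function of the choice of the sets $\mathcal{I}=\{I_e\}_{e\in E}$ of real numbers, each such that $\sin$ restricted to $I_e$ is injective. The maximum value of $|W(A)|$ is achieved if we choose $$I_e=\begin{cases}[-\pi/2,\pi/2]&\text{if }\gamma_e>0,\\ [\pi/2,3\pi/2]&\text{if }\gamma_e<0,\end{cases}\qquad\text{for all }e\in E,$$ or $$I_e=\begin{cases}[\pi/2,3\pi/2]&\text{if }\gamma_e>0,\\ [-\pi/2,\pi/2]&\text{if }\gamma_e<0,\end{cases}\qquad\text{for all }e\in E.$$ In particular, if all of the edge weights are positive, then the maximum is achieved if all of the angle differences are less than or equal to $\pi/2$ (that is, $I_e=[-\pi/2,\pi/2]$ for all $e$) or all greater than or equal to $\pi/2$ (that is, $I_e=[\pi/2,3\pi/2]$ for all $e$).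
   Context: Fix an ordering and an orientation of the edges. The incidence matrix $B:\mathbb{R}^E\to\mathbb{R}^V$ has $B_{ie}=1$ if $i$ is the head of $e$, $-1$ if $i$ is the tail of $e$, and $0$ otherwise; $B^{-1}$ denotes its pseudoinverse. The cycle space is the additive group of integral vectors in $\ker B$; a cycle basis is a $\mathbb{Z}$-basis of it, and $c=|E|-|V|+1$. $D_\gamma$ is the diagonal matrix with entries $\gamma_e$. $\sin_\mathcal{I}$ is the componentwise sine function restricted to $\prod_{e\in E}I_e$, with inverse $\sin_\mathcal{I}^{-1}$. For $\alpha\in\mathbb{R}^c$, $$L(\alpha)=D_\gamma^{-1}B^{-1}\omega+\sum_{i=1}^c\alpha_iD_\gamma^{-1}v_i,\qquad W(\alpha)=\frac1{2\pi}\left(\langle v_1,\sin_\mathcal{I}^{-1}L(\alpha)\rangle,\dots,\langle v_c,\sin_\mathcal{I}^{-1}L(\alpha)\rangle\right).$$ $A\subseteq\mathbb{R}^c$ is the set of $\alpha$ for which $\sin_\mathcal{I}^{-1}L(\alpha)$ is well-defined, i.e. $L(\alpha)_e\in\sin(I_e)$ for all $e\in E$. The angle difference along an edge $e$ with head $i$ and tail $j$ is $\theta_e=\theta_i-\theta_j$, restricted to lie in $I_e+2\pi\mathbb{Z}$.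
   Formalization: The sets I_e are additionally required to be Lebesgue measurable; for arbitrary sets on which sin is injective, W(A) can be non-measurable, so its volume is undefined (and with outer measure the claim fails). *)

theory Defs
  imports "HOL-Analysis.Analysis"
begin

text \<open>
  The vertices, the edges and the indices of a cycle basis are the elements of finite types
  \<open>'v\<close>, \<open>'e\<close>, \<open>'c\<close>; an oriented graph is given by the maps \<open>head\<close>, \<open>tail\<close> from \<open>'e\<close> to \<open>'v\<close>.
  All graph-theoretic notions below refer to the underlying undirected graph.
\<close>

definition simple_graph :: "('e \<Rightarrow> 'v) \<Rightarrow> ('e \<Rightarrow> 'v) \<Rightarrow> bool" where
  "simple_graph head tail \<longleftrightarrow>
     (\<forall>e. head e \<noteq> tail e) \<and> (\<forall>e f. {head e, tail e} = {head f, tail f} \<longrightarrow> e = f)"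

definition adjacency :: "('e \<Rightarrow> 'v) \<Rightarrow> ('e \<Rightarrow> 'v) \<Rightarrow> 'e set \<Rightarrow> ('v \<times> 'v) set" where
  "adjacency head tail F = {(u, v). \<exists>e\<in>F. {u, v} = {head e, tail e}}"

text \<open>In the next three definitions \<open>F\<close> stands for the graph with all vertices and edge set \<open>F\<close>.\<close>

definition graph_connected :: "('e \<Rightarrow> 'v) \<Rightarrow> ('e \<Rightarrow> 'v) \<Rightarrow> 'e set \<Rightarrow> bool" where
  "graph_connected head tail F \<longleftrightarrow> (\<forall>u v. (u, v) \<in> (adjacency head tail F)\<^sup>*)"

definition graph_cycle :: "('e \<Rightarrow> 'v) \<Rightarrow> ('e \<Rightarrow> 'v) \<Rightarrow> 'e set \<Rightarrow> 'v list \<Rightarrow> bool" where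
  "graph_cycle head tail F p \<longleftrightarrow> 3 \<le> length p \<and> distinct p \<and>
     (\<forall>k<length p. (p ! k, p ! (Suc k mod length p)) \<in> adjacency head tail F)"

definition spanning_tree :: "('e \<Rightarrow> 'v) \<Rightarrow> ('e \<Rightarrow> 'v) \<Rightarrow> 'e set \<Rightarrow> bool" where
  "spanning_tree head tail F \<longleftrightarrow>
     graph_connected head tail F \<and> (\<nexists>p. graph_cycle head tail F p)"

definition incidence_matrix ::
    "('e::finite \<Rightarrow> 'v::finite) \<Rightarrow> ('e \<Rightarrow> 'v) \<Rightarrow> real^'e^'v" where
  "incidence_matrix head tail =
     (\<chi> i e. if i = head e then 1 else if i = tail e then -1 else 0)"

text \<open>Moore--Penrose pseudoinverse, by the four Penrose equations.\<close>

definition pseudoinverse :: "real^'n^'m \<Rightarrow> real^'m^'n" where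
  "pseudoinverse M = (THE X. M ** X ** M = M \<and> X ** M ** X = X \<and>
     transpose (M ** X) = M ** X \<and> transpose (X ** M) = X ** M)"

definition diagonal_matrix :: "('n::finite \<Rightarrow> real) \<Rightarrow> real^'n^'n" where
  "diagonal_matrix d = (\<chi> i j. if i = j then d i else 0)"

definition cycle_space ::
    "('e::finite \<Rightarrow> 'v::finite) \<Rightarrow> ('e \<Rightarrow> 'v) \<Rightarrow> (real^'e) set" where
  "cycle_space head tail = {x. incidence_matrix head tail *v x = 0 \<and> (\<forall>e. x $ e \<in> \<int>)}"

definition cycle_basis ::
    "('e::finite \<Rightarrow> 'v::finite) \<Rightarrow> ('e \<Rightarrow> 'v) \<Rightarrow> ('c::finite \<Rightarrow> real^'e) \<Rightarrow> bool" where
  "cycle_basis head tail v \<longleftrightarrow> (\<forall>i. v i \<in> cycle_space head tail) \<and>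
     (\<forall>x \<in> cycle_space head tail. \<exists>!a :: 'c \<Rightarrow> int. x = (\<Sum>i\<in>UNIV. of_int (a i) *\<^sub>R v i))"

definition L_map ::
    "('e::finite \<Rightarrow> 'v::finite) \<Rightarrow> ('e \<Rightarrow> 'v) \<Rightarrow> ('e \<Rightarrow> real) \<Rightarrow> ('c::finite \<Rightarrow> real^'e) \<Rightarrow> real^'v
      \<Rightarrow> real^'c \<Rightarrow> real^'e" where
  "L_map head tail \<gamma> v \<omega> \<alpha> =
     matrix_inv (diagonal_matrix \<gamma>) *v (pseudoinverse (incidence_matrix head tail) *v \<omega>)
     + (\<Sum>i\<in>UNIV. (\<alpha> $ i) *\<^sub>R (matrix_inv (diagonal_matrix \<gamma>) *v v i))"

definition sin_inv :: "('e::finite \<Rightarrow> real set) \<Rightarrow> real^'e \<Rightarrow> real^'e" where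
  "sin_inv I x = (\<chi> e. the_inv_into (I e) sin (x $ e))"

definition A_set ::
    "('e::finite \<Rightarrow> 'v::finite) \<Rightarrow> ('e \<Rightarrow> 'v) \<Rightarrow> ('e \<Rightarrow> real) \<Rightarrow> ('c::finite \<Rightarrow> real^'e) \<Rightarrow> real^'v
      \<Rightarrow> ('e \<Rightarrow> real set) \<Rightarrow> (real^'c) set" where
  "A_set head tail \<gamma> v \<omega> I = {\<alpha>. \<forall>e. L_map head tail \<gamma> v \<omega> \<alpha> $ e \<in> sin ` I e}"

definition W_map ::
    "('e::finite \<Rightarrow> 'v::finite) \<Rightarrow> ('e \<Rightarrow> 'v) \<Rightarrow> ('e \<Rightarrow> real) \<Rightarrow> ('c::finite \<Rightarrow> real^'e) \<Rightarrow> real^'v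
      \<Rightarrow> ('e \<Rightarrow> real set) \<Rightarrow> real^'c \<Rightarrow> real^'c" where
  "W_map head tail \<gamma> v \<omega> I \<alpha> =
     (1 / (2 * pi)) *\<^sub>R (\<chi> i. v i \<bullet> sin_inv I (L_map head tail \<gamma> v \<omega> \<alpha>))"

definition W_image ::
    "('e::finite \<Rightarrow> 'v::finite) \<Rightarrow> ('e \<Rightarrow> 'v) \<Rightarrow> ('e \<Rightarrow> real) \<Rightarrow> ('c::finite \<Rightarrow> real^'e) \<Rightarrow> real^'v
      \<Rightarrow> ('e \<Rightarrow> real set) \<Rightarrow> (real^'c) set" where
  "W_image head tail \<gamma> v \<omega> I =
     W_map head tail \<gamma> v \<omega> I ` A_set head tail \<gamma> v \<omega> I"

text \<open>
  Measurability of the \<open>I e\<close> makes the volume of the image of \<open>W\<close> meaningful: for arbitrary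
  \<open>I e\<close> that image need not be measurable.
\<close>

definition admissible :: "('e \<Rightarrow> real set) \<Rightarrow> bool" where
  "admissible I \<longleftrightarrow> (\<forall>e. I e \<in> sets lebesgue \<and> inj_on sin (I e))"

end

theory Submission
  imports Defs
begin

text \<open>
  The set \<open>A\<close> splits into countably many pieces on which the \<open>e\<close>-th inverse sine is
  \<open>a\<^sub>e + s\<^sub>e arcsin\<close> with a sign \<open>s\<^sub>e\<close>, so on a piece the Jacobian determinant of \<open>W\<close> is
  \<open>det (\<Sum>\<^sub>e c\<^sub>e u\<^sub>e u\<^sub>e\<^sup>T)\<close> with \<open>c\<^sub>e = s\<^sub>e / (\<gamma>\<^sub>e sqrt (1 - L\<^sub>e\<^sup>2))\<close>, up to a constant factor.
  By Cauchy--Binet this is a polynomial in the \<open>c\<^sub>e\<close> with nonnegative coefficients, homogeneous of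
  degree \<open>c\<close>; hence its absolute value is largest when all \<open>c\<^sub>e\<close> have the same sign, which is what
  the two optimal choices of intervals achieve. For these choices \<open>W\<close> is a strictly monotone map
  up to sign, hence injective, so the volume of its image equals the integral of the Jacobian, which
  for any other choice is an upper bound.
\<close>

subsection \<open>Determinants of weighted Gram matrices\<close>

text \<open>Cauchy-Binet, summed over all maps \<open>f\<close> from rows to edges instead of sets
  of edges: each set of \<open>CARD('c)\<close> edges occurs once per ordering, hence the factor on
  the left, and a non-injective \<open>f\<close> contributes zero because of a repeated row.\<close>

lemma det_weighted_gram:
  fixes u :: "'e::finite \<Rightarrow> real^'c::finite" and d :: "'e \<Rightarrow> real"
  shows "real (card {p. p permutes (UNIV :: 'c set)}) * det (\<chi> i j. \<Sum>e\<in>UNIV. d e * u e $ i * u e $ j)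
    = (\<Sum>f\<in>UNIV. (\<Prod>i\<in>UNIV. d (f i)) * (det (\<chi> i. u (f i)))\<^sup>2)"
proof -
  let ?P = "{p. p permutes (UNIV :: 'c set)}"
  let ?G = "\<lambda>f :: 'c \<Rightarrow> 'e. (\<Prod>i\<in>UNIV. d (f i) * u (f i) $ i) * det (\<chi> i. u (f i))"
  have "det (\<chi> i j. \<Sum>e\<in>UNIV. d e * u e $ i * u e $ j)
      = (\<Sum>p\<in>?P. of_int (sign p) * (\<Sum>f\<in>UNIV. \<Prod>i\<in>UNIV. d (f i) * u (f i) $ i * u (f i) $ p i))"
    by (simp add: det_def prod_sum_PiE)
  also have "\<dots> = sum ?G UNIV"
    unfolding det_def sum_distrib_left
    by (subst sum.swap) (simp add: prod.distrib mult_ac)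
  finally have det: "det (\<chi> i j. \<Sum>e\<in>UNIV. d e * u e $ i * u e $ j) = sum ?G UNIV" .
  \<comment> \<open>Precomposition with \<open>p\<close> permutes the summands, so the sum may be
    averaged over all \<open>p\<close>; this turns the diagonal product into a second
    determinant.\<close>
  have reindex: "sum ?G UNIV = (\<Sum>f\<in>UNIV. ?G (f \<circ> p))" if p: "p permutes UNIV" for p
  proof (rule sum.reindex_bij_witness[where i = "\<lambda>f. f \<circ> p" and j = "\<lambda>f. f \<circ> inv p"])
    show "(f \<circ> inv p) \<circ> p = f" "(f \<circ> p) \<circ> inv p = f" for f
      using p by (auto simp: fun_eq_iff permutes_inverses)
  next
    fix f show "?G ((f \<circ> inv p) \<circ> p) = ?G f"
      using p by (simp add: permutes_inverses)
  qed auto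
  have G: "?G (f \<circ> p) = (\<Prod>i\<in>UNIV. d (f i)) * det (\<chi> i. u (f i)) * (of_int (sign p) * (\<Prod>i\<in>UNIV. u (f (p i)) $ i))"
    if p: "p permutes UNIV" for f p
  proof -
    have "det (\<chi> i. (\<chi> i. u (f i)) $ p i) = of_int (sign p) * det (\<chi> i. u (f i))"
      using p by (rule det_permute_rows)
    moreover have "(\<Prod>i\<in>UNIV. d (f (p i))) = (\<Prod>i\<in>UNIV. d (f i))"
      using prod.permute[OF p, of "\<lambda>i. d (f i)"] by (simp add: o_def)
    ultimately show ?thesis by (simp add: prod.distrib)
  qed
  have leibniz: "(\<Sum>p\<in>?P. of_int (sign p) * (\<Prod>i\<in>UNIV. u (f (p i)) $ i)) = det (\<chi> i. u (f i))" for f :: "'c \<Rightarrow> 'e"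
    by (subst det_transpose[symmetric]) (simp add: det_def transpose_def)
  have "real (card ?P) * sum ?G UNIV = (\<Sum>p\<in>?P. sum ?G UNIV)"
    by simp
  also have "\<dots> = (\<Sum>p\<in>?P. \<Sum>f\<in>UNIV. ?G (f \<circ> p))"
    by (rule sum.cong[OF refl], rule reindex) simp
  also have "\<dots> = (\<Sum>p\<in>?P. \<Sum>f\<in>UNIV. (\<Prod>i\<in>UNIV. d (f i)) * det (\<chi> i. u (f i)) * (of_int (sign p) * (\<Prod>i\<in>UNIV. u (f (p i)) $ i)))"
    using G by (intro sum.cong refl) blast
  also have "\<dots> = (\<Sum>f\<in>UNIV. (\<Prod>i\<in>UNIV. d (f i)) * det (\<chi> i. u (f i)) * (\<Sum>p\<in>?P. of_int (sign p) * (\<Prod>i\<in>UNIV. u (f (p i)) $ i)))"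
    by (subst sum.swap) (simp add: sum_distrib_left)
  also have "\<dots> = (\<Sum>f\<in>UNIV. (\<Prod>i\<in>UNIV. d (f i)) * (det (\<chi> i. u (f i)))\<^sup>2)"
    by (simp only: leibniz power2_eq_square mult.assoc)
  finally show ?thesis unfolding det .
qed

text \<open>The hypothesis forces \<open>\<epsilon> * d e \<ge> 0\<close> for all \<open>e\<close>,
  so no two terms in the expansion for \<open>d\<close> have opposite signs and nothing cancels; the
  triangle inequality bounds the expansion for \<open>a\<close> term by term.\<close>

lemma abs_det_weighted_gram_le:
  fixes u :: "'e::finite \<Rightarrow> real^'c::finite"
  assumes le: "\<And>e. \<bar>a e\<bar> \<le> \<epsilon> * d e" and \<epsilon>: "\<bar>\<epsilon>\<bar> = 1"
  shows "\<bar>det (\<chi> i j. \<Sum>e\<in>UNIV. a e * u e $ i * u e $ j)\<bar>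
    \<le> \<bar>det (\<chi> i j. \<Sum>e\<in>UNIV. d e * u e $ i * u e $ j)\<bar>"
proof -
  let ?N = "real (card {p. p permutes (UNIV :: 'c set)})"
  have pos: "?N > 0"
    using permutes_id by (auto simp: card_gt_0_iff intro!: exI[of _ id])
  have "?N * \<bar>det (\<chi> i j. \<Sum>e\<in>UNIV. a e * u e $ i * u e $ j)\<bar>
      = \<bar>\<Sum>f\<in>UNIV. (\<Prod>i\<in>UNIV. a (f i)) * (det (\<chi> i. u (f i)))\<^sup>2\<bar>"
    by (simp flip: det_weighted_gram add: abs_mult)
  also have "\<dots> \<le> (\<Sum>f\<in>UNIV. \<bar>\<Prod>i\<in>UNIV. a (f i)\<bar> * (det (\<chi> i. u (f i)))\<^sup>2)"
    by (rule order_trans[OF sum_abs]) (simp add: abs_mult)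
  also have "\<dots> \<le> (\<Sum>f\<in>UNIV. (\<Prod>i\<in>UNIV. \<epsilon> * d (f i)) * (det (\<chi> i. u (f i)))\<^sup>2)"
    using le by (intro sum_mono mult_right_mono) (auto simp: abs_prod intro!: prod_mono)
  also have "\<dots> = \<epsilon> ^ CARD('c) * (\<Sum>f\<in>UNIV. (\<Prod>i\<in>UNIV. d (f i)) * (det (\<chi> i. u (f i)))\<^sup>2)"
    by (simp add: prod.distrib sum_distrib_left mult.assoc)
  also have "\<dots> \<le> \<bar>\<epsilon> ^ CARD('c) * (\<Sum>f\<in>UNIV. (\<Prod>i\<in>UNIV. d (f i)) * (det (\<chi> i. u (f i)))\<^sup>2)\<bar>"
    by (rule abs_ge_self)
  also have "\<dots> = ?N * \<bar>det (\<chi> i j. \<Sum>e\<in>UNIV. d e * u e $ i * u e $ j)\<bar>"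
    using \<epsilon> by (simp flip: det_weighted_gram add: abs_mult power_abs)
  finally show ?thesis using pos by simp
qed

subsection \<open>Lebesgue measurability of preimages under linear functionals\<close>

lemma null_sets_component_vimage:
  fixes b :: "'a::euclidean_space"
  assumes b: "b \<in> Basis" and N: "N \<in> null_sets (lborel :: real measure)"
  shows "{x. x \<bullet> b \<in> N} \<in> null_sets lborel"
proof -
  have [measurable]: "N \<in> sets borel" using N by auto
  let ?f = "\<lambda>c y. if c = b then indicator N y else 1 :: ennreal"
  have "emeasure lborel {x. x \<bullet> b \<in> N} = (\<integral>\<^sup>+x. indicator N (x \<bullet> b) \<partial>lborel)"
  proof -
    have "(\<lambda>x. indicator N (x \<bullet> b)) = (indicator {x. x \<bullet> b \<in> N} :: 'a \<Rightarrow> ennreal)"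
      by (auto simp: indicator_def)
    then show ?thesis by simp
  qed
  also have "\<dots> = (\<integral>\<^sup>+x. (\<Prod>c\<in>Basis. ?f c (x \<bullet> c)) \<partial>lborel)"
    using b by (intro nn_integral_cong) simp
  also have "\<dots> = (\<Prod>c\<in>Basis. \<integral>\<^sup>+y. ?f c y \<partial>lborel)"
    by (rule nn_integral_lborel_prod) auto
  \<comment> \<open>The factor at \<open>b\<close> vanishes; the others are infinite, but zero times
    infinity is zero in \<open>ennreal\<close>.\<close>
  also have "\<dots> = 0"
    using b N by (intro prod_zero) (auto intro!: bexI[of _ b])
  finally show ?thesis by (auto simp: null_sets_def)
qed

lemma null_sets_functional_vimage:
  fixes w :: "'a::euclidean_space"
  assumes w: "w \<noteq> 0" and N: "N \<in> null_sets (lborel :: real measure)"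
  shows "{x. c + w \<bullet> x \<in> N} \<in> null_sets lebesgue"
proof -
  obtain b where b: "b \<in> Basis" "w \<bullet> b \<noteq> 0"
    using w euclidean_all_zero_iff by blast
  \<comment> \<open>\<open>f\<close> replaces the \<open>b\<close>-coordinate by
    \<open>w \<bullet> x\<close>, which reduces the claim to a single coordinate; it is invertible
    because \<open>w \<bullet> b \<noteq> 0\<close>.\<close>
  define f where "f x = x + (w \<bullet> x - x \<bullet> b) *\<^sub>R b" for x
  have lin: "linear f"
    by (intro linearI) (auto simp: f_def algebra_simps inner_simps)
  have fb: "f x \<bullet> b = w \<bullet> x" for x
    using b by (simp add: f_def inner_simps)
  have "inj f"
  proof (rule linear_injective_0[THEN iffD2, OF lin], intro allI impI)
    fix x assume x: "f x = 0"
    then have wx: "w \<bullet> x = 0" using fb[of x] by simp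
    then have eq: "x = (x \<bullet> b) *\<^sub>R b" using x by (simp add: f_def)
    have "(x \<bullet> b) * (w \<bullet> b) = w \<bullet> ((x \<bullet> b) *\<^sub>R b)"
      by simp
    also have "\<dots> = 0"
      using wx by (simp only: eq[symmetric])
    finally have "x \<bullet> b = 0" using b by simp
    then show "x = 0" by (subst eq) simp
  qed
  then obtain g where g: "linear g" "\<forall>x. g (f x) = x"
    using linear_injective_isomorphism[OF lin] by blast
  have "negligible ((+) (- c) ` N)"
    using N by (intro negligible_translation) (simp add: negligible_iff_null_sets null_sets_completionI)
  then have N': "(\<lambda>y. y - c) ` N \<in> null_sets lebesgue"
    by (simp add: negligible_iff_null_sets)
  \<comment> \<open>The translate is so far only Lebesgue null; it is enlarged to a Borel null set
    to fit \<open>null_sets_component_vimage\<close>.\<close>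
  obtain N1 where N1: "N1 \<in> null_sets lborel" "(\<lambda>y. y - c) ` N \<subseteq> N1"
    using N' unfolding null_sets_completion_iff2 by blast
  have "{x. c + w \<bullet> x \<in> N} \<subseteq> g ` {x. x \<bullet> b \<in> N1}"
  proof
    fix x assume "x \<in> {x. c + w \<bullet> x \<in> N}"
    then have "(c + w \<bullet> x) - c \<in> N1"
      using N1(2) by (metis image_eqI mem_Collect_eq subsetD)
    then have "f x \<in> {x. x \<bullet> b \<in> N1}"
      by (simp add: fb)
    then have "g (f x) \<in> g ` {x. x \<bullet> b \<in> N1}"
      by (rule imageI)
    then show "x \<in> g ` {x. x \<bullet> b \<in> N1}"
      by (simp only: g(2))
  qed
  moreover have "negligible (g ` {x. x \<bullet> b \<in> N1})"
    by (intro negligible_differentiable_image_negligible linear_imp_differentiable_on g(1))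
      (use null_sets_component_vimage[OF b(1) N1(1)] in \<open>auto simp: negligible_iff_null_sets null_sets_completionI\<close>)
  ultimately show ?thesis
    using negligible_subset negligible_iff_null_sets by blast
qed

text \<open>To pull back Lebesgue sets, Borel measurability is not enough: preimages of null sets
  must be null, which holds for \<open>w \<noteq> 0\<close>. For \<open>w = 0\<close> the preimage
  is empty or everything.\<close>

lemma lebesgue_sets_functional_vimage:
  fixes w :: "'a::euclidean_space" and T :: "real set"
  assumes T: "T \<in> sets lebesgue"
  shows "{x. c + w \<bullet> x \<in> T} \<in> sets lebesgue"
proof (cases "w = 0")
  case True
  then show ?thesis by (cases "c \<in> T") auto
next
  case False
  have [measurable]: "(\<lambda>x. c + w \<bullet> x) \<in> borel_measurable lebesgue"
    by (intro measurable_completion) measurable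
  have "(\<lambda>x. c + w \<bullet> x) \<in> lebesgue \<rightarrow>\<^sub>M lebesgue"
  proof (rule completion.measurable_completion2)
    show "(\<lambda>x. c + w \<bullet> x) \<in> lebesgue \<rightarrow>\<^sub>M lborel" by simp
    show "null_sets lborel \<subseteq> null_sets (distr lebesgue lborel (\<lambda>x. c + w \<bullet> x))"
    proof
      fix N :: "real set" assume N: "N \<in> null_sets lborel"
      then have "{x. c + w \<bullet> x \<in> N} \<in> null_sets lebesgue" "N \<in> sets borel"
        using null_sets_functional_vimage[OF False] by auto
      then show "N \<in> null_sets (distr lebesgue lborel (\<lambda>x. c + w \<bullet> x))"
        by (simp add: null_sets_distr_iff vimage_def)
    qed
  qed
  from measurable_sets[OF this T] show ?thesis
    by (simp add: vimage_def)
qed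

subsection \<open>Reindexing coordinates\<close>

text \<open>The change of variables theorems of the library require a well-ordered index type.\<close>

typedef 'a wo = "UNIV :: 'a set" ..

lemma Rep_Abs_wo [simp]: "Rep_wo (Abs_wo x) = x"
  by (simp add: Abs_wo_inverse)

lemma bij_Rep_wo: "bij Rep_wo"
  by (rule o_bij[of Abs_wo]) (auto simp: fun_eq_iff Rep_wo_inverse)

instance wo :: (finite) finite
proof
  have "inj (Rep_wo :: 'a wo \<Rightarrow> 'a)" using bij_Rep_wo bij_is_inj by blast
  then show "finite (UNIV :: 'a wo set)"
    by (rule finite_imageD[OF finite])
qed

instantiation wo :: (finite) wellorder
begin

definition wo_index :: "'a wo \<Rightarrow> nat" where
  "wo_index = to_nat_on UNIV"

definition "x \<le> y \<longleftrightarrow> wo_index x \<le> wo_index y" for x y :: "'a wo"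
definition "x < y \<longleftrightarrow> wo_index x < wo_index y" for x y :: "'a wo"

instance
proof
  have inj: "x = y" if "wo_index x = wo_index y" for x y :: "'a wo"
    using that inj_onD[OF inj_on_to_nat_on[OF countable_finite[OF finite]]]
    unfolding wo_index_def by blast
  fix x y z :: "'a wo"
  show "x < y \<longleftrightarrow> x \<le> y \<and> \<not> y \<le> x" "x \<le> x" "x \<le> y \<Longrightarrow> y \<le> z \<Longrightarrow> x \<le> z"
    "x \<le> y \<Longrightarrow> y \<le> x \<Longrightarrow> x = y" "x \<le> y \<or> y \<le> x"
    unfolding less_eq_wo_def less_wo_def by (linarith, linarith, linarith, rule inj, linarith, linarith)
  fix P :: "'a wo \<Rightarrow> bool" and a
  assume step: "\<And>x. (\<And>y. y < x \<Longrightarrow> P y) \<Longrightarrow> P x"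
  show "P a"
    by (rule measure_induct_rule[of wo_index], rule step) (simp only: less_wo_def)
qed

end

definition reindex :: "('d \<Rightarrow> 'c) \<Rightarrow> real^'c \<Rightarrow> real^'d" where
  "reindex p x = (\<chi> j. x $ p j)"

lemma reindex_component [simp]: "reindex p x $ j = x $ p j"
  by (simp add: reindex_def)

text \<open>Permuting coordinates carries boxes to boxes with the same side lengths, and
  \<open>lborel\<close> is determined by its values on boxes.\<close>

lemma lborel_distr_reindex:
  fixes p :: "'d::finite \<Rightarrow> 'c::finite"
  assumes p: "bij p"
  shows "distr lborel borel (reindex p) = (lborel :: (real^'d) measure)"
proof (rule lborel_eqI[symmetric])
  have [measurable]: "reindex p \<in> borel_measurable borel"
    unfolding reindex_def by (intro borel_measurable_continuous_onI continuous_intros)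
  fix l u :: "real^'d"
  assume lu: "\<And>b. b \<in> Basis \<Longrightarrow> l \<bullet> b \<le> u \<bullet> b"
  then have le: "l $ j \<le> u $ j" for j
    by (metis axis_in_Basis_iff cart_eq_inner_axis Basis_real_def insertI1)
  have prod_Basis: "(\<Prod>b\<in>Basis. (y - x) \<bullet> b) = (\<Prod>i\<in>UNIV. y $ i - x $ i)"
    for x y :: "real^'n::finite"
    by (simp add: Basis_vec_def axis_eq_axis UNION_singleton_eq_range prod.reindex inj_on_def inner_axis o_def)
  define l' u' where "l' = reindex (inv p) l" and "u' = reindex (inv p) u"
  have "reindex p -` box l u = box l' u'"
  proof (intro set_eqI)
    fix x
    have "(\<forall>j. l $ j < x $ p j \<and> x $ p j < u $ j)
        \<longleftrightarrow> (\<forall>i. l $ inv p i < x $ i \<and> x $ i < u $ inv p i)"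
      using p by (metis bij_inv_eq_iff)
    then show "x \<in> reindex p -` box l u \<longleftrightarrow> x \<in> box l' u'"
      by (simp add: mem_box_cart l'_def u'_def)
  qed
  then have "emeasure (distr lborel borel (reindex p)) (box l u) = emeasure lborel (box l' u')"
    by (simp add: emeasure_distr)
  also have "\<dots> = ennreal (\<Prod>i\<in>UNIV. u' $ i - l' $ i)"
    using le by (subst emeasure_lborel_box, unfold prod_Basis) (auto simp: Basis_vec_def inner_axis l'_def u'_def)
  also have "(\<Prod>i\<in>UNIV. u' $ i - l' $ i) = (\<Prod>j\<in>UNIV. u $ j - l $ j)"
    unfolding l'_def u'_def using p prod.reindex_bij_betw[of "inv p" UNIV UNIV "\<lambda>j. u $ j - l $ j"]
    by (simp add: bij_imp_bij_inv)
  finally show "emeasure (distr lborel borel (reindex p)) (box l u) = (\<Prod>b\<in>Basis. (u - l) \<bullet> b)"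
    by (simp add: prod_Basis)
qed simp

lemma lmeasurable_reindex_vimage:
  fixes p :: "'d::finite \<Rightarrow> 'c::finite"
  assumes p: "bij p" and S: "S \<in> lmeasurable"
  shows "reindex p -` S \<in> lmeasurable" "measure lebesgue (reindex p -` S) = measure lebesgue S"
proof -
  have [measurable]: "reindex p \<in> borel_measurable borel"
    unfolding reindex_def by (intro borel_measurable_continuous_onI continuous_intros)
  have m: "reindex p \<in> lebesgue \<rightarrow>\<^sub>M lborel"
    by (intro measurable_completion) measurable
  have d: "distr lebesgue lborel (reindex p) = lborel"
    using lborel_distr_reindex[OF p] by (subst distr_completion) (auto cong: distr_cong)
  have m': "reindex p \<in> lebesgue \<rightarrow>\<^sub>M lebesgue"
    by (rule completion.measurable_completion2[OF m]) (simp add: d)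
  have "distr lebesgue lebesgue (reindex p) = (lebesgue :: (real^'d) measure)"
    using completion.completion_distr_eq[OF m] by (simp add: d)
  then have em: "emeasure lebesgue (reindex p -` S) = emeasure lebesgue S"
    using emeasure_distr[OF m', of S] S by auto
  show "reindex p -` S \<in> lmeasurable"
    using measurable_sets[OF m', of S] S em by (auto simp: fmeasurable_def)
  show "measure lebesgue (reindex p -` S) = measure lebesgue S"
    using em by (simp add: measure_def)
qed

subsection \<open>Branches of the inverse sine\<close>

text \<open>The fibres of \<open>cell\<close> are the odd multiples of \<open>pi / 2\<close> and the open intervals between them.\<close>

definition cell :: "real \<Rightarrow> int \<times> int" where
  "cell y = (\<lfloor>y / pi + 1 / 2\<rfloor>, \<lceil>y / pi + 1 / 2\<rceil>)"

lemma cell_borel: "cell -` {p} \<in> sets borel"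
proof -
  have "cell -` {p} = {y. \<lfloor>y / pi + 1 / 2\<rfloor> = fst p} \<inter> {y. \<lceil>y / pi + 1 / 2\<rceil> = snd p}"
    by (auto simp: cell_def)
  also have "\<dots> \<in> sets borel"
    by measurable
  finally show ?thesis .
qed

lemma cos_int_pi: "\<bar>cos (of_int k * pi)\<bar> = 1" and sin_int_pi: "sin (of_int k * pi) = 0"
proof -
  show s: "sin (of_int k * pi) = 0"
    using sin_zero_iff_int2 by blast
  then show "\<bar>cos (of_int k * pi)\<bar> = 1"
    using sin_cos_squared_add[of "of_int k * pi"] by (simp add: power2_eq_1_iff abs_if) linarith
qed

text \<open>Subtracting the multiple of \<open>pi\<close> given by the floor moves \<open>y\<close>
  into the range of \<open>arcsin\<close>; the shift multiplies the sine by the sign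
  \<open>cos (of_int (fst p) * pi)\<close>.\<close>

lemma sin_cell:
  assumes "cell y = p"
  shows "y = of_int (fst p) * pi + cos (of_int (fst p) * pi) * arcsin (sin y)"
proof -
  let ?k = "of_int (fst p) :: real" and ?s = "cos (of_int (fst p) * pi)"
  have "?k \<le> y / pi + 1 / 2" "y / pi + 1 / 2 < ?k + 1"
    using assms by (auto simp: cell_def)
  then have bd: "- (pi / 2) \<le> y - ?k * pi" "y - ?k * pi \<le> pi / 2"
    using pi_gt_zero by (simp_all add: field_simps)
  have "sin (?k * pi + (y - ?k * pi)) = ?s * sin (y - ?k * pi)"
    by (subst sin_add) (simp add: sin_int_pi)
  then have "sin y = ?s * sin (y - ?k * pi)"
    by simp
  then have "arcsin (sin y) = ?s * (y - ?k * pi)"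
    using cos_int_pi[of "fst p"] bd
    by (auto simp: abs_if arcsin_minus arcsin_sin split: if_splits)
  then show ?thesis
    using cos_int_pi[of "fst p"] by (auto simp: abs_if split: if_splits)
qed

text \<open>Isolates the points where \<open>arcsin\<close> is not differentiable: they form cells
  of their own, with equal floor and ceiling.\<close>

lemma sin_cell_cases:
  obtains (point) y0 where "\<bar>sin y0\<bar> = 1" "\<And>y. cell y = p \<Longrightarrow> y = y0"
  | (interval) "\<And>y. cell y = p \<Longrightarrow> \<bar>sin y\<bar> < 1"
proof (cases "fst p = snd p")
  case True
  let ?y = "of_int (fst p) * pi - pi / 2"
  have "\<bar>sin ?y\<bar> = 1"
    by (simp add: sin_diff cos_int_pi)
  moreover have "y = ?y" if "cell y = p" for y
  proof -
    have "\<lfloor>y / pi + 1 / 2\<rfloor> = fst p" "\<lceil>y / pi + 1 / 2\<rceil> = fst p"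
      using that True by (auto simp: cell_def)
    then have "y / pi + 1 / 2 = of_int (fst p)"
      by linarith
    then show ?thesis by (simp add: field_simps)
  qed
  ultimately show ?thesis by (rule point)
next
  case False
  have "\<bar>sin y\<bar> < 1" if "cell y = p" for y
  proof -
    let ?k = "of_int (fst p) :: real"
    have f: "\<lfloor>y / pi + 1 / 2\<rfloor> = fst p" "\<lceil>y / pi + 1 / 2\<rceil> \<noteq> fst p"
      using that False by (auto simp: cell_def)
    then have "?k < y / pi + 1 / 2" "y / pi + 1 / 2 < ?k + 1"
      by linarith+
    then have "- (pi / 2) < y - ?k * pi" "y - ?k * pi < pi / 2"
      using pi_gt_zero by (simp_all add: field_simps)
    then have "cos (y - ?k * pi) > 0"
      by (intro cos_gt_zero_pi) auto
    then have "cos y \<noteq> 0"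
      by (auto simp: cos_diff sin_int_pi)
    then have "(sin y)\<^sup>2 < 1"
      using sin_cos_squared_add[of y] by (smt (verit) zero_less_power2)
    then show ?thesis by (simp add: abs_square_less_1)
  qed
  then show ?thesis by (rule interval)
qed

lemma arcsin_diff_mult_pos:
  assumes "\<bar>x\<bar> \<le> 1" "\<bar>y\<bar> \<le> 1" "x \<noteq> y"
  shows "(arcsin x - arcsin y) * (x - y) > 0"
proof (cases "x < y")
  case True
  then show ?thesis
    using assms arcsin_less_mono[of x y] by (intro mult_neg_neg) auto
next
  case False
  then show ?thesis
    using assms arcsin_less_mono[of y x] by (intro mult_pos_pos) auto
qed

lemma sin_image_cell_lebesgue:
  assumes "X \<in> sets lebesgue"
  shows "sin ` (X \<inter> cell -` {p}) \<in> sets (lebesgue :: real measure)"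
proof (rule differentiable_image_in_sets_lebesgue)
  show "X \<inter> cell -` {p} \<in> sets lebesgue"
    using assms cell_borel[of p] by (intro sets.Int) auto
  show "(sin :: real \<Rightarrow> real) differentiable_on X \<inter> cell -` {p}"
    unfolding differentiable_on_def
    by (meson DERIV_sin differentiableI has_field_derivative_imp_has_derivative has_field_derivative_at_within differentiable_def)
qed simp

subsection \<open>Comparison of volumes\<close>

text \<open>The integral of the Jacobian is the volume of the image for the injective
  \<open>h\<close>, but only an upper bound for \<open>f\<close>.\<close>

lemma measure_image_le_if_det_le:
  fixes f h :: "real^'n::{finite,wellorder} \<Rightarrow> real^'n::_"
  assumes S: "S \<in> sets lebesgue"
    and f: "\<And>x. x \<in> S \<Longrightarrow> (f has_derivative f' x) (at x within S)"
    and h: "\<And>x. x \<in> S \<Longrightarrow> (h has_derivative h' x) (at x within S)"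
    and inj: "inj_on h S" and bounded: "bounded (h ` S)"
    and det: "\<And>x. x \<in> S \<Longrightarrow> \<bar>det (matrix (f' x))\<bar> \<le> \<bar>det (matrix (h' x))\<bar>"
  shows "f ` S \<in> lmeasurable" "h ` S \<in> lmeasurable"
    "measure lebesgue (f ` S) \<le> measure lebesgue (h ` S)"
proof -
  have "h differentiable_on S"
    unfolding differentiable_on_def differentiable_def using h by blast
  then show hS: "h ` S \<in> lmeasurable"
    by (intro bounded_set_imp_lmeasurable[OF bounded] differentiable_image_in_sets_lebesgue S) auto
  \<comment> \<open>Integrability of the Jacobian is read off from the finite volume of the image,
    which boundedness provides.\<close>
  then have inth: "(\<lambda>x. \<bar>det (matrix (h' x))\<bar>) integrable_on S"
    using measurable_differentiable_image_eq[OF S h inj] by blast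
  have intf: "(\<lambda>x. \<bar>det (matrix (f' x))\<bar>) integrable_on S"
    by (rule measurable_bounded_by_integrable_imp_integrable[OF _ inth _ S])
      (use borel_measurable_det_Jacobian[OF S f] det in auto)
  show "f ` S \<in> lmeasurable"
    using measurable_differentiable_image[OF S f intf] .
  have "measure lebesgue (f ` S) \<le> integral S (\<lambda>x. \<bar>det (matrix (f' x))\<bar>)"
    using measure_differentiable_image[OF S f intf] .
  also have "\<dots> \<le> integral S (\<lambda>x. \<bar>det (matrix (h' x))\<bar>)"
    by (rule integral_le[OF intf inth det])
  also have "\<dots> = measure lebesgue (h ` S)"
    using measure_differentiable_image_eq[OF S h inj inth] by simp
  finally show "measure lebesgue (f ` S) \<le> measure lebesgue (h ` S)" .
qed

text \<open>In the paper's notation, \<open>u e\<close> has the coordinates \<open>v\<^sub>i(e) / (2 * pi)\<close>, and \<open>g e = 2 * pi / \<gamma>\<^sub>e\<close>;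
  then \<open>flow\<close>, \<open>feasible\<close> and \<open>wind\<close> are \<open>L\<close>, \<open>A\<close> and \<open>W\<close>.\<close>

locale winding =
  fixes u :: "'e::finite \<Rightarrow> real^'c::{finite,wellorder}" and b g :: "'e \<Rightarrow> real"
  assumes g_nonzero: "g e \<noteq> 0"
begin

definition flow :: "real^'c::_ \<Rightarrow> 'e \<Rightarrow> real" where
  "flow \<alpha> e = b e + g e * (u e \<bullet> \<alpha>)"

definition feasible :: "('e \<Rightarrow> real set) \<Rightarrow> (real^'c::_) set" where
  "feasible I = {\<alpha>. \<forall>e. flow \<alpha> e \<in> sin ` I e}"

definition wind :: "('e \<Rightarrow> real set) \<Rightarrow> real^'c::_ \<Rightarrow> real^'c::_" where
  "wind I \<alpha> = (\<Sum>e\<in>UNIV. the_inv_into (I e) sin (flow \<alpha> e) *\<^sub>R u e)"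

text \<open>With free \<open>a\<close> and \<open>s\<close>, one formula covers both
  \<open>wind I\<close> on a single piece and the optimal \<open>wind\<close> on its whole
  domain.\<close>

definition branch :: "('e \<Rightarrow> real) \<Rightarrow> ('e \<Rightarrow> real) \<Rightarrow> real^'c::_ \<Rightarrow> real^'c::_" where
  "branch a s \<alpha> = (\<Sum>e\<in>UNIV. (a e + s e * arcsin (flow \<alpha> e)) *\<^sub>R u e)"

definition piece :: "('e \<Rightarrow> real set) \<Rightarrow> ('e \<Rightarrow> int \<times> int) \<Rightarrow> (real^'c::_) set" where
  "piece I p = {\<alpha>. \<forall>e. flow \<alpha> e \<in> sin ` (I e \<inter> cell -` {p e})}"

lemma pieceE:
  assumes "\<alpha> \<in> piece I p"
  obtains y where "y \<in> I e" "cell y = p e" "flow \<alpha> e = sin y"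
proof -
  have "flow \<alpha> e \<in> sin ` (I e \<inter> cell -` {p e})"
    using assms by (simp add: piece_def)
  then show ?thesis
    by (auto intro: that)
qed

lemma piece_subset_feasible: "piece I p \<subseteq> feasible I"
  by (auto simp: piece_def feasible_def)

lemma abs_flow_le: "\<alpha> \<in> feasible I \<Longrightarrow> \<bar>flow \<alpha> e\<bar> \<le> 1"
  by (auto simp: feasible_def dest!: spec[of _ e])

lemma feasible_eq_Union_pieces: "feasible I = (\<Union>p. piece I p)"
proof
  show "feasible I \<subseteq> (\<Union>p. piece I p)"
  proof
    fix \<alpha> assume "\<alpha> \<in> feasible I"
    then have "\<forall>e. \<exists>y. y \<in> I e \<and> sin y = flow \<alpha> e"
      unfolding feasible_def by (metis (mono_tags) imageE mem_Collect_eq)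
    then obtain y where "\<forall>e. y e \<in> I e \<and> sin (y e) = flow \<alpha> e"
      by metis
    then have "flow \<alpha> e \<in> sin ` (I e \<inter> cell -` {cell (y e)})" for e
      by (intro image_eqI[of _ _ "y e"]) auto
    then have "\<alpha> \<in> piece I (\<lambda>e. cell (y e))"
      by (simp add: piece_def)
    then show "\<alpha> \<in> (\<Union>p. piece I p)" by blast
  qed
qed (use piece_subset_feasible in blast)

text \<open>By injectivity of sine on \<open>I e\<close>, the value of \<open>flow\<close>
  determines the angle and hence its cell.\<close>

lemma pieces_disjoint:
  assumes inj: "\<And>e. inj_on sin (I e)" and "\<alpha> \<in> piece I p" "\<alpha> \<in> piece I q"
  shows "p = q"
proof
  fix e
  obtain y where "y \<in> I e" "cell y = p e" "flow \<alpha> e = sin y"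
    by (rule pieceE[OF assms(2)])
  moreover obtain z where "z \<in> I e" "cell z = q e" "flow \<alpha> e = sin z"
    by (rule pieceE[OF assms(3)])
  ultimately show "p e = q e"
    using inj_onD[OF inj, of y z e] by simp
qed

lemma piece_lebesgue:
  assumes "\<And>e. I e \<in> sets lebesgue"
  shows "piece I p \<in> sets lebesgue"
proof -
  have "piece I p = (\<Inter>e. {\<alpha>. b e + (g e *\<^sub>R u e) \<bullet> \<alpha> \<in> sin ` (I e \<inter> cell -` {p e})})"
    by (auto simp: piece_def flow_def)
  also have "\<dots> \<in> sets lebesgue"
    using assms by (intro sets.finite_INT lebesgue_sets_functional_vimage sin_image_cell_lebesgue) auto
  finally show ?thesis .
qed

lemma wind_eq_branch:
  assumes inj: "\<And>e. inj_on sin (I e)" and \<alpha>: "\<alpha> \<in> piece I p"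
  shows "wind I \<alpha> = branch (\<lambda>e. of_int (fst (p e)) * pi) (\<lambda>e. cos (of_int (fst (p e)) * pi)) \<alpha>"
  unfolding wind_def branch_def
proof (intro sum.cong refl arg_cong[of _ _ "\<lambda>t. t *\<^sub>R _"])
  fix e
  obtain y where y: "y \<in> I e" "cell y = p e" "flow \<alpha> e = sin y"
    by (rule pieceE[OF \<alpha>])
  then have "the_inv_into (I e) sin (flow \<alpha> e) = y"
    using the_inv_into_f_f[OF inj, of y e] by simp
  then show "the_inv_into (I e) sin (flow \<alpha> e)
      = of_int (fst (p e)) * pi + cos (of_int (fst (p e)) * pi) * arcsin (flow \<alpha> e)"
    using sin_cell[OF y(2)] y(3) by simp
qed

lemma flow_has_derivative:
  "((\<lambda>\<alpha>. flow \<alpha> e) has_derivative (\<lambda>h. g e * (u e \<bullet> h))) F"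
  unfolding flow_def by (auto intro!: derivative_eq_intros)

text \<open>Where \<open>\<bar>flow \<alpha> e\<bar> = 1\<close>, \<open>flow\<close> is constant along the piece, and the formula
  below is correct because division by zero gives zero.\<close>

lemma branch_has_derivative:
  assumes \<alpha>: "\<alpha> \<in> piece I p"
  shows "(branch a s has_derivative
    (\<lambda>h. \<Sum>e\<in>UNIV. (s e * g e / sqrt (1 - (flow \<alpha> e)\<^sup>2) * (u e \<bullet> h)) *\<^sub>R u e)) (at \<alpha> within piece I p)"
  unfolding branch_def
proof (rule has_derivative_sum)
  fix e
  have cell: "\<exists>y. cell y = p e \<and> flow \<beta> e = sin y" if "\<beta> \<in> piece I p" for \<beta>
    using pieceE[OF that, of e] by metis
  let ?D = "\<lambda>h. (s e * g e / sqrt (1 - (flow \<alpha> e)\<^sup>2) * (u e \<bullet> h)) *\<^sub>R u e"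
  show "((\<lambda>\<alpha>. (a e + s e * arcsin (flow \<alpha> e)) *\<^sub>R u e) has_derivative ?D) (at \<alpha> within piece I p)"
  proof (cases rule: sin_cell_cases[of "p e"])
    case (point y)
    have const: "flow \<beta> e = sin y" if "\<beta> \<in> piece I p" for \<beta>
      using cell[OF that] point(2) by blast
    have "(flow \<alpha> e)\<^sup>2 = 1"
      using point(1) const[OF \<alpha>] by (simp add: abs_square_eq_1)
    then have "?D = (\<lambda>h. 0)" by simp
    moreover have "((\<lambda>\<alpha>. (a e + s e * arcsin (flow \<alpha> e)) *\<^sub>R u e) has_derivative (\<lambda>h. 0)) (at \<alpha> within piece I p)"
      by (rule has_derivative_transform[OF \<alpha> _ has_derivative_const[of "(a e + s e * arcsin (sin y)) *\<^sub>R u e"]])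
        (simp add: const)
    ultimately show ?thesis by simp
  next
    case interval
    then have lt: "- 1 < flow \<alpha> e" "flow \<alpha> e < 1"
      using cell[OF \<alpha>] by (auto simp: abs_less_iff)
    have "((\<lambda>\<alpha>. arcsin (flow \<alpha> e)) has_derivative (\<lambda>h. inverse (sqrt (1 - (flow \<alpha> e)\<^sup>2)) * (g e * (u e \<bullet> h)))) (at \<alpha> within piece I p)"
      using DERIV_compose_FDERIV[OF DERIV_arcsin[OF lt] flow_has_derivative] by (simp add: mult.commute)
    from has_derivative_scaleR_left[OF has_derivative_add[OF has_derivative_const[of "a e"]
        has_derivative_mult_right[OF this, of "s e"]], of "u e"]
    show ?thesis by (simp add: divide_inverse mult_ac)
  qed
qed

text \<open>Brings the Jacobian matrix of a branch into the form treated by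
  \<open>abs_det_weighted_gram_le\<close>.\<close>

lemma matrix_branch_derivative:
  "matrix (\<lambda>h. \<Sum>e\<in>UNIV. (d e * (u e \<bullet> h)) *\<^sub>R u e) = (\<chi> i j. \<Sum>e\<in>UNIV. d e * u e $ i * u e $ j)"
  by (simp add: matrix_def vec_eq_iff inner_axis mult_ac)

text \<open>Supplies finite volume even though the derivative of \<open>arcsin\<close> is unbounded
  near the ends of its domain.\<close>

lemma bounded_branch_image: "bounded (branch a s ` feasible I)"
proof -
  have "norm (branch a s \<alpha>) \<le> (\<Sum>e\<in>UNIV. (\<bar>a e\<bar> + \<bar>s e\<bar> * pi) * norm (u e))" if "\<alpha> \<in> feasible I" for \<alpha>
    unfolding branch_def
  proof (rule sum_norm_le)
    fix e
    have "- (pi / 2) \<le> arcsin (flow \<alpha> e) \<and> arcsin (flow \<alpha> e) \<le> pi / 2"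
      using abs_flow_le[OF that, of e] by (intro conjI arcsin_lbound arcsin_ubound) (auto simp: abs_le_iff)
    then have "\<bar>arcsin (flow \<alpha> e)\<bar> \<le> pi"
      using pi_gt_zero by (auto simp: abs_le_iff)
    then have "\<bar>a e + s e * arcsin (flow \<alpha> e)\<bar> \<le> \<bar>a e\<bar> + \<bar>s e\<bar> * pi"
      by (intro order_trans[OF abs_triangle_ineq] add_left_mono) (simp add: abs_mult mult_left_mono)
    then show "norm ((a e + s e * arcsin (flow \<alpha> e)) *\<^sub>R u e) \<le> (\<bar>a e\<bar> + \<bar>s e\<bar> * pi) * norm (u e)"
      by (simp add: mult_right_mono)
  qed
  then show ?thesis by (auto simp: bounded_iff)
qed

text \<open>Up to the sign \<open>\<epsilon>\<close>, \<open>branch a s\<close> is the gradient of a strictly convex function.\<close>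

lemma inj_on_branch:
  assumes s: "\<And>e. \<epsilon> * (s e * g e) = \<bar>g e\<bar>" and span: "span (range u) = UNIV"
  shows "inj_on (branch a s) (feasible I)"
proof (rule inj_onI)
  fix \<alpha> \<beta> assume \<alpha>: "\<alpha> \<in> feasible I" and \<beta>: "\<beta> \<in> feasible I" and eq: "branch a s \<alpha> = branch a s \<beta>"
  \<comment> \<open>\<open>?t e\<close> is the contribution of \<open>e\<close> to \<epsilon> times
    the inner product of \<open>branch a s \<alpha> - branch a s \<beta>\<close> with
    \<open>\<alpha> - \<beta>\<close>, written so that monotonicity of \<open>arcsin\<close> shows
    its sign.\<close>
  let ?t = "\<lambda>e. \<bar>g e\<bar> / (g e)\<^sup>2 * ((arcsin (flow \<alpha> e) - arcsin (flow \<beta> e)) * (flow \<alpha> e - flow \<beta> e))"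
  have t: "?t e \<ge> 0 \<and> (?t e = 0 \<longrightarrow> flow \<alpha> e = flow \<beta> e)" for e
  proof (cases "flow \<alpha> e = flow \<beta> e")
    case False
    then have "(arcsin (flow \<alpha> e) - arcsin (flow \<beta> e)) * (flow \<alpha> e - flow \<beta> e) > 0"
      using abs_flow_le[OF \<alpha>, of e] abs_flow_le[OF \<beta>, of e]
      by (intro arcsin_diff_mult_pos)
    with g_nonzero[of e] have "?t e > 0"
      by (simp only: mult_pos_pos zero_less_divide_iff zero_less_abs_iff zero_less_power2 simp_thms)
    then show ?thesis by linarith
  qed simp
  have summand: "?t e = \<epsilon> * (s e * (arcsin (flow \<alpha> e) - arcsin (flow \<beta> e)) * (u e \<bullet> (\<alpha> - \<beta>)))" for e
  proof -
    have "flow \<alpha> e - flow \<beta> e = g e * (u e \<bullet> (\<alpha> - \<beta>))"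
      by (simp add: flow_def inner_diff_right algebra_simps)
    then show ?thesis
      using g_nonzero[of e] by (simp add: s[symmetric] power2_eq_square)
  qed
  have "branch a s \<alpha> - branch a s \<beta>
      = (\<Sum>e\<in>UNIV. (s e * (arcsin (flow \<alpha> e) - arcsin (flow \<beta> e))) *\<^sub>R u e)"
    unfolding branch_def sum_subtractf[symmetric] by (intro sum.cong refl) (simp add: algebra_simps)
  then have "(\<Sum>e\<in>UNIV. ?t e) = \<epsilon> * ((branch a s \<alpha> - branch a s \<beta>) \<bullet> (\<alpha> - \<beta>))"
    by (simp only: summand inner_sum_left inner_scaleR_left sum_distrib_left)
  also have "\<dots> = 0" using eq by simp
  finally have "?t e = 0" for e
    using t by (subst (asm) sum_nonneg_eq_0_iff) auto
  then have eq_flow: "flow \<alpha> e = flow \<beta> e" for e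
    using t by blast
  have "u e \<bullet> (\<alpha> - \<beta>) = 0" for e
    using eq_flow[of e] g_nonzero[of e] by (simp add: flow_def inner_diff_right)
  \<comment> \<open>The \<open>u e\<close> span the space, so a vector orthogonal to all of them is
    orthogonal to itself.\<close>
  then have "orthogonal (\<alpha> - \<beta>) x" if "x \<in> span (range u)" for x
    using that by (intro orthogonal_to_span[of x "range u"]) (auto simp: orthogonal_def inner_commute)
  then have "orthogonal (\<alpha> - \<beta>) (\<alpha> - \<beta>)" using span by blast
  then show "\<alpha> = \<beta>" by (simp add: orthogonal_self)
qed

lemma wind_piece_le:
  assumes s: "\<And>e. \<epsilon> * (s e * g e) = \<bar>g e\<bar>" and \<epsilon>: "\<bar>\<epsilon>\<bar> = 1"
    and span: "span (range u) = UNIV"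
    and leb: "\<And>e. I e \<in> sets lebesgue" and inj: "\<And>e. inj_on sin (I e)"
  shows "wind I ` piece I p \<in> lmeasurable" "branch a s ` piece I p \<in> lmeasurable"
    "measure lebesgue (wind I ` piece I p) \<le> measure lebesgue (branch a s ` piece I p)"
proof -
  let ?a = "\<lambda>e. of_int (fst (p e)) * pi" and ?s = "\<lambda>e. cos (of_int (fst (p e)) * pi)"
  have wind: "wind I ` piece I p = branch ?a ?s ` piece I p"
    using wind_eq_branch[OF inj] by (rule image_cong[OF refl])
  have det: "\<bar>det (matrix (\<lambda>h. \<Sum>e\<in>UNIV. (?s e * g e / sqrt (1 - (flow \<alpha> e)\<^sup>2) * (u e \<bullet> h)) *\<^sub>R u e))\<bar>
      \<le> \<bar>det (matrix (\<lambda>h. \<Sum>e\<in>UNIV. (s e * g e / sqrt (1 - (flow \<alpha> e)\<^sup>2) * (u e \<bullet> h)) *\<^sub>R u e))\<bar>"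
    if "\<alpha> \<in> piece I p" for \<alpha>
    unfolding matrix_branch_derivative
  proof (rule abs_det_weighted_gram_le[OF _ \<epsilon>])
    fix e
    have "(flow \<alpha> e)\<^sup>2 \<le> 1"
      using abs_flow_le that piece_subset_feasible abs_square_le_1 by blast
    \<comment> \<open>Both sides are equal, since \<open>?s e\<close> is a sign; if
      \<open>(flow \<alpha> e)\<^sup>2 = 1\<close>, both are zero by division by zero.\<close>
    then show "\<bar>?s e * g e / sqrt (1 - (flow \<alpha> e)\<^sup>2)\<bar> \<le> \<epsilon> * (s e * g e / sqrt (1 - (flow \<alpha> e)\<^sup>2))"
      using s[of e] by (simp add: abs_mult cos_int_pi)
  qed
  note * = measure_image_le_if_det_le[OF piece_lebesgue[OF leb] branch_has_derivative branch_has_derivative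
    inj_on_subset[OF inj_on_branch[OF s span] piece_subset_feasible]
    bounded_subset[OF bounded_branch_image image_mono[OF piece_subset_feasible]] det]
  show "wind I ` piece I p \<in> lmeasurable" "branch a s ` piece I p \<in> lmeasurable"
    "measure lebesgue (wind I ` piece I p) \<le> measure lebesgue (branch a s ` piece I p)"
    unfolding wind using * by auto
qed

text \<open>The comparison is made piece by piece: the pieces of \<open>feasible I\<close> are disjoint, and so are their
  images under the injective map \<open>branch a s\<close>.\<close>

lemma wind_image_le:
  assumes s: "\<And>e. \<epsilon> * (s e * g e) = \<bar>g e\<bar>" and \<epsilon>: "\<bar>\<epsilon>\<bar> = 1"
    and span: "span (range u) = UNIV"
    and I: "admissible I" and J: "admissible J"
    and feasible_J: "\<And>\<alpha>. (\<And>e. \<bar>flow \<alpha> e\<bar> \<le> 1) \<Longrightarrow> \<alpha> \<in> feasible J"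
    and wind_J: "\<And>\<alpha>. \<alpha> \<in> feasible J \<Longrightarrow> wind J \<alpha> = branch a s \<alpha>"
  shows "wind I ` feasible I \<in> lmeasurable"
    "measure lebesgue (wind I ` feasible I) \<le> measure lebesgue (wind J ` feasible J)"
proof -
  have adm: "K e \<in> sets lebesgue" "inj_on sin (K e)" if "admissible K" for K :: "'e \<Rightarrow> real set" and e
    using that by (auto simp: admissible_def)
  note le = wind_piece_le[OF s \<epsilon> span adm[OF I]]
  have sets: "wind K ` feasible K \<in> sets lebesgue" if "admissible K" for K
    unfolding feasible_eq_Union_pieces image_UN
    using wind_piece_le(1)[OF s \<epsilon> span adm[OF that]]
    by (intro sets.countable_UN'') auto
  have "wind J ` feasible J = branch a s ` feasible J"
    using wind_J by (rule image_cong[OF refl])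
  then have fin: "wind J ` feasible J \<in> lmeasurable"
    using sets[OF J] bounded_branch_image by (intro bounded_set_imp_lmeasurable) auto
  \<comment> \<open>Enumerates the pieces by natural numbers. Numbers that encode no
    \<open>p\<close> get the empty set, so that no piece is repeated and the family stays
    disjoint.\<close>
  define X where
    "X n = (if to_nat (from_nat n :: 'e \<Rightarrow> int \<times> int) = n then piece I (from_nat n) else {})" for n
  have X_piece: "X (to_nat p) = piece I p" for p
    by (simp add: X_def)
  have X_cases: "\<exists>p. n = to_nat p \<and> X n = piece I p" if "X n \<noteq> {}" for n
  proof -
    have n: "to_nat (from_nat n :: 'e \<Rightarrow> int \<times> int) = n"
      using that unfolding X_def by metis
    then have "X n = piece I (from_nat n)"
      unfolding X_def by (rule if_P)
    with n show ?thesis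
      by (intro exI[of _ "from_nat n"] conjI) (rule sym)
  qed
  have feasible_I: "feasible I = (\<Union>n. X n)"
  proof (intro equalityI subsetI)
    fix \<alpha> assume "\<alpha> \<in> feasible I"
    then obtain p where "\<alpha> \<in> piece I p"
      unfolding feasible_eq_Union_pieces by blast
    then have "\<alpha> \<in> X (to_nat p)"
      by (simp only: X_piece)
    then show "\<alpha> \<in> (\<Union>n. X n)" by blast
  next
    fix \<alpha> assume "\<alpha> \<in> (\<Union>n. X n)"
    then obtain n where "\<alpha> \<in> X n" by blast
    then show "\<alpha> \<in> feasible I"
      using X_cases[of n] piece_subset_feasible by blast
  qed
  have X: "wind I ` X n \<in> lmeasurable" "branch a s ` X n \<in> lmeasurable"
    "measure lebesgue (wind I ` X n) \<le> measure lebesgue (branch a s ` X n)" for n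
    using le by (auto simp: X_def)
  have disj: "disjoint_family (\<lambda>n. branch a s ` X n)"
    unfolding disjoint_family_on_def
  proof (intro ballI impI)
    fix m n :: nat assume "m \<noteq> n"
    have "X m \<inter> X n = {}"
    proof (rule ccontr)
      assume "X m \<inter> X n \<noteq> {}"
      then obtain \<alpha> where \<alpha>: "\<alpha> \<in> X m" "\<alpha> \<in> X n" by blast
      then obtain p q where "m = to_nat p" "X m = piece I p" "n = to_nat q" "X n = piece I q"
        using X_cases[of m] X_cases[of n] by blast
      moreover from this have "p = q"
        using pieces_disjoint[of I, OF adm(2)[OF I]] \<alpha> by blast
      ultimately show False using \<open>m \<noteq> n\<close> by simp
    qed
    moreover have "X m \<subseteq> feasible I" "X n \<subseteq> feasible I"
      using feasible_I by auto
    ultimately show "branch a s ` X m \<inter> branch a s ` X n = {}"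
      using inj_on_image_Int[OF inj_on_branch[OF s span]] by (metis image_empty)
  qed
  have "emeasure lebesgue (wind I ` feasible I) = emeasure lebesgue (\<Union>n. wind I ` X n)"
    by (simp add: feasible_I image_UN)
  \<comment> \<open>Only subadditivity is available, because \<open>wind I\<close> may identify
    points of different pieces.\<close>
  also have "\<dots> \<le> (\<Sum>n. emeasure lebesgue (wind I ` X n))"
    using X by (intro emeasure_subadditive_countably) auto
  also have "\<dots> \<le> (\<Sum>n. emeasure lebesgue (branch a s ` X n))"
    using X by (intro suminf_le) (auto simp: emeasure_eq_measure2)
  also have "\<dots> = emeasure lebesgue (\<Union>n. branch a s ` X n)"
    using X disj by (intro suminf_emeasure) auto
  also have "\<dots> \<le> emeasure lebesgue (wind J ` feasible J)"
  proof (rule emeasure_mono)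
    have "feasible I \<subseteq> feasible J"
      using feasible_J abs_flow_le by blast
    then have "branch a s ` feasible I \<subseteq> branch a s ` feasible J"
      by (rule image_mono)
    then show "(\<Union>n. branch a s ` X n) \<subseteq> wind J ` feasible J"
      using \<open>wind J ` feasible J = branch a s ` feasible J\<close> by (simp add: feasible_I image_UN)
  qed (rule sets[OF J])
  finally have em: "emeasure lebesgue (wind I ` feasible I) \<le> emeasure lebesgue (wind J ` feasible J)" .
  show lm: "wind I ` feasible I \<in> lmeasurable"
    using sets[OF I] em fin by (auto simp: fmeasurable_def)
  show "measure lebesgue (wind I ` feasible I) \<le> measure lebesgue (wind J ` feasible J)"
    using em lm fin by (simp add: emeasure_eq_measure2)
qed

text \<open>Settles the degenerate case in which \<open>inj_on_branch\<close> does not apply: the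
  image lies in a proper subspace.\<close>

lemma wind_image_negligible:
  assumes "span (range u) \<noteq> UNIV"
  shows "negligible (wind I ` feasible I)"
proof (rule negligible_subset)
  show "wind I ` feasible I \<subseteq> span (range u)"
    unfolding wind_def by (intro image_subsetI span_sum span_scale span_base rangeI)
  show "negligible (span (range u))"
    using assms by (intro negligible_lowdim) (metis dim_eq_full dim_span dim_subset_UNIV le_neq_implies_less)
qed

end

section \<open>The optimal choices of intervals\<close>

abbreviation (input) half_turns :: "('e \<Rightarrow> bool) \<Rightarrow> 'e \<Rightarrow> real set" where
  "half_turns P e \<equiv> if P e then {-pi/2..pi/2} else {pi/2..3*pi/2}"

lemma inj_on_sin_half_turns: "inj_on sin (half_turns P e)"
proof -
  have "inj_on sin {pi/2..3*pi/2}"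
  proof (rule inj_onI)
    fix x y :: real assume xy: "x \<in> {pi/2..3*pi/2}" "y \<in> {pi/2..3*pi/2}" "sin x = sin y"
    \<comment> \<open>The reflection of \<open>x\<close> to \<open>pi - x\<close> preserves the sine
      and maps this interval onto the principal one.\<close>
    then have "- (pi / 2) \<le> pi - x" "pi - x \<le> pi / 2" "- (pi / 2) \<le> pi - y" "pi - y \<le> pi / 2"
      by (simp_all only: atLeastAtMost_iff) linarith+
    moreover have "sin (pi - x) = sin (pi - y)"
      by (simp only: sin_pi_minus xy(3))
    ultimately have "pi - x = pi - y"
      by (rule sin_inj_pi)
    then show "x = y" by simp
  qed
  moreover have "inj_on sin {-pi/2..pi/2}"
  proof (rule inj_onI)
    fix x y :: real assume xy: "x \<in> {-pi/2..pi/2}" "y \<in> {-pi/2..pi/2}" "sin x = sin y"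
    then have "- (pi / 2) \<le> x" "x \<le> pi / 2" "- (pi / 2) \<le> y" "y \<le> pi / 2"
      by (simp_all only: atLeastAtMost_iff) linarith+
    then show "x = y"
      using xy(3) by (rule sin_inj_pi)
  qed
  ultimately show ?thesis by simp
qed

lemma admissible_half_turns: "admissible (half_turns P)"
  using inj_on_sin_half_turns[of P] by (simp add: admissible_def)

text \<open>The inverse sine is \<open>arcsin x\<close> on one interval and
  \<open>pi - arcsin x\<close> on the other, so \<open>wind\<close> for half turns is a single
  branch.\<close>

lemma half_turn_arcsin:
  fixes P :: "'e \<Rightarrow> bool"
  assumes "\<bar>x\<bar> \<le> 1"
  defines "y \<equiv> \<lambda>e. (if P e then 0 else pi) + (if P e then 1 else -1) * arcsin x"
  shows "y e \<in> half_turns P e" "sin (y e) = x" "the_inv_into (half_turns P e) sin x = y e"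
proof -
  have x: "-1 \<le> x" "x \<le> 1" using assms by auto
  show y: "y e \<in> half_turns P e"
    using arcsin_lbound[OF x] arcsin_ubound[OF x] by (auto simp: y_def field_simps)
  show "sin (y e) = x" using x by (simp add: y_def)
  then show "the_inv_into (half_turns P e) sin x = y e"
    using y by (intro the_inv_into_f_eq inj_on_sin_half_turns)
qed

text \<open>The condition on \<epsilon> says that the signs chosen through \<open>P\<close> give all
  weights \<open>s e * g e\<close> the same sign \<epsilon>.\<close>

lemma (in winding) wind_image_le_half_turns:
  assumes \<epsilon>: "\<bar>\<epsilon>\<bar> = 1" "\<And>e. \<epsilon> * ((if P e then 1 else -1) * g e) = \<bar>g e\<bar>" and I: "admissible I"
  shows "wind I ` feasible I \<in> lmeasurable"
    "measure lebesgue (wind I ` feasible I) \<le> measure lebesgue (wind (half_turns P) ` feasible (half_turns P))"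
proof -
  have feasible: "\<alpha> \<in> feasible (half_turns P)" if "\<And>e. \<bar>flow \<alpha> e\<bar> \<le> 1" for \<alpha>
    unfolding feasible_def
  proof (intro CollectI allI)
    fix e show "flow \<alpha> e \<in> sin ` half_turns P e"
      by (rule image_eqI[where f = sin, OF half_turn_arcsin(2)[OF that, symmetric, where P = P and e = e]
            half_turn_arcsin(1)[OF that, where P = P and e = e]])
  qed
  have wind: "wind (half_turns P) \<alpha> = branch (\<lambda>e. if P e then 0 else pi) (\<lambda>e. if P e then 1 else -1) \<alpha>"
    if "\<alpha> \<in> feasible (half_turns P)" for \<alpha>
    unfolding wind_def branch_def half_turn_arcsin(3)[OF abs_flow_le[OF that]] ..
  note le = wind_image_le[OF \<epsilon>(2,1) _ I admissible_half_turns feasible wind]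
  have "wind I ` feasible I \<in> lmeasurable
      \<and> measure lebesgue (wind I ` feasible I) \<le> measure lebesgue (wind (half_turns P) ` feasible (half_turns P))"
  proof (cases "span (range u) = UNIV")
    case True
    then show ?thesis by (intro conjI le)
  next
    case False
    then have "negligible (wind I ` feasible I)" by (rule wind_image_negligible)
    then show ?thesis
      by (simp only: negligible_imp_measurable negligible_imp_measure0 measure_nonneg simp_thms)
  qed
  then show "wind I ` feasible I \<in> lmeasurable"
    "measure lebesgue (wind I ` feasible I) \<le> measure lebesgue (wind (half_turns P) ` feasible (half_turns P))"
    by (rule conjunct1, rule conjunct2)
qed

section \<open>Transfer to the incidence matrix setting\<close>

lemma matrix_inv_diagonal_mult:
  assumes "\<And>i. d i \<noteq> 0"
  shows "(matrix_inv (diagonal_matrix d) *v x) $ i = x $ i / d i"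
proof -
  have mult: "diagonal_matrix a ** diagonal_matrix b = diagonal_matrix (\<lambda>i. a i * b i)" for a b :: "'a \<Rightarrow> real"
    by (simp add: matrix_matrix_mult_def diagonal_matrix_def vec_eq_iff if_distrib[of "\<lambda>t. _ * t"] cong: if_cong)
  have "diagonal_matrix d ** diagonal_matrix (\<lambda>i. 1 / d i) = mat 1"
    "diagonal_matrix (\<lambda>i. 1 / d i) ** diagonal_matrix d = mat 1"
    unfolding mult using assms by (auto simp: diagonal_matrix_def mat_def)
  \<comment> \<open>\<open>matrix_inv\<close> is a choice, so a two-sided inverse has to be
    exhibited before anything is known about it.\<close>
  then have "\<exists>M. diagonal_matrix d ** M = mat 1 \<and> M ** diagonal_matrix d = mat 1"
    by (intro exI conjI)
  from someI_ex[OF this] have "diagonal_matrix d ** matrix_inv (diagonal_matrix d) = mat 1"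
    unfolding matrix_inv_def by (rule conjunct1)
  then have "diagonal_matrix d *v (matrix_inv (diagonal_matrix d) *v x) = x"
    by (simp add: matrix_vector_mul_assoc)
  then have "(diagonal_matrix d *v (matrix_inv (diagonal_matrix d) *v x)) $ i = x $ i"
    by (rule arg_cong)
  moreover have "(diagonal_matrix d *v y) $ i = d i * y $ i" for y
    by (simp add: matrix_vector_mult_def diagonal_matrix_def if_distrib[of "\<lambda>t. t * _"] cong: if_cong)
  ultimately show ?thesis
    using assms[of i] by (simp add: field_simps)
qed

lemma W_image_le:
  fixes head tail :: "'e::finite \<Rightarrow> 'v::finite" and v :: "'c::finite \<Rightarrow> real^'e"
  assumes weights: "\<And>e. \<gamma> e \<noteq> 0" and P: "P = (\<lambda>e. \<gamma> e > 0) \<or> P = (\<lambda>e. \<not> \<gamma> e > 0)"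
    and I: "admissible I"
  shows "W_image head tail \<gamma> v \<omega> I \<in> lmeasurable"
    "measure lebesgue (W_image head tail \<gamma> v \<omega> I) \<le> measure lebesgue (W_image head tail \<gamma> v \<omega> (half_turns P))"
proof -
  \<comment> \<open>The same \<open>u e\<close> must serve in \<open>flow\<close> and in
    \<open>wind\<close>: the factor \<open>1 / (2 * pi)\<close> of \<open>W_map\<close> goes into
    \<open>u\<close>, and \<open>g\<close> compensates for it in \<open>flow\<close>.\<close>
  define u :: "'e \<Rightarrow> real^'c wo" where "u e = (\<chi> j. v (Rep_wo j) $ e / (2 * pi))" for e
  define b where
    "b e = (matrix_inv (diagonal_matrix \<gamma>) *v (pseudoinverse (incidence_matrix head tail) *v \<omega>)) $ e" for e
  define g where "g e = 2 * pi / \<gamma> e" for e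
  interpret winding u b g
    by unfold_locales (simp add: g_def weights)
  let ?R = "reindex Rep_wo :: real^'c \<Rightarrow> real^'c wo"
  have flow: "L_map head tail \<gamma> v \<omega> \<alpha> $ e = flow (?R \<alpha>) e" for \<alpha> e
  proof -
    have "(\<Sum>i\<in>UNIV. \<alpha> $ i * (v i $ e / \<gamma> e)) = (\<Sum>j\<in>UNIV. \<alpha> $ Rep_wo j * (v (Rep_wo j) $ e / \<gamma> e))"
      by (rule sum.reindex_bij_betw[OF bij_Rep_wo, symmetric])
    then show ?thesis
      by (simp add: L_map_def flow_def b_def g_def u_def matrix_inv_diagonal_mult[OF weights]
          inner_vec_def sum_distrib_left mult_ac)
  qed
  have wind: "?R (W_map head tail \<gamma> v \<omega> K \<alpha>) = wind K (?R \<alpha>)" for K \<alpha>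
    by (simp add: vec_eq_iff W_map_def wind_def u_def sin_inv_def flow inner_vec_def sum_divide_distrib mult_ac)
  have bij: "\<exists>!\<alpha>. ?R \<alpha> = \<beta>" for \<beta>
  proof (rule ex1I)
    show "?R (\<chi> i. \<beta> $ Abs_wo i) = \<beta>"
      by (simp add: vec_eq_iff Rep_wo_inverse)
    show "\<alpha> = (\<chi> i. \<beta> $ Abs_wo i)" if "?R \<alpha> = \<beta>" for \<alpha>
      by (simp add: vec_eq_iff that[symmetric])
  qed
  \<comment> \<open>Stated as a preimage, the form in which
    \<open>lmeasurable_reindex_vimage\<close> transfers volumes; equality rests on bijectivity of
    \<open>?R\<close>.\<close>
  have image: "W_image head tail \<gamma> v \<omega> K = ?R -` (wind K ` feasible K)" for K
  proof (intro set_eqI iffI)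
    fix y assume "y \<in> W_image head tail \<gamma> v \<omega> K"
    then show "y \<in> ?R -` (wind K ` feasible K)"
      by (auto simp: W_image_def A_set_def feasible_def wind flow)
  next
    fix y assume "y \<in> ?R -` (wind K ` feasible K)"
    then obtain \<beta> where "\<beta> \<in> feasible K" "?R y = wind K \<beta>" by auto
    moreover obtain \<alpha> where "?R \<alpha> = \<beta>" using bij by blast
    ultimately have "\<alpha> \<in> A_set head tail \<gamma> v \<omega> K" "?R y = ?R (W_map head tail \<gamma> v \<omega> K \<alpha>)"
      by (auto simp: A_set_def feasible_def wind flow)
    then show "y \<in> W_image head tail \<gamma> v \<omega> K"
      using bij unfolding W_image_def by (metis image_eqI)
  qed
  obtain \<epsilon> :: real where \<epsilon>: "\<bar>\<epsilon>\<bar> = 1" "\<epsilon> * ((if P e then 1 else -1) * g e) = \<bar>g e\<bar>" for e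
  proof (cases "P = (\<lambda>e. \<gamma> e > 0)")
    case True
    then show ?thesis by (intro that[of 1]) (auto simp: g_def)
  next
    case False
    then show ?thesis using P by (intro that[of "-1"]) (auto simp: g_def)
  qed
  show "W_image head tail \<gamma> v \<omega> I \<in> lmeasurable"
    "measure lebesgue (W_image head tail \<gamma> v \<omega> I) \<le> measure lebesgue (W_image head tail \<gamma> v \<omega> (half_turns P))"
    unfolding image
    using wind_image_le_half_turns[OF \<epsilon>] I admissible_half_turns[of P] lmeasurable_reindex_vimage[OF bij_Rep_wo]
    by metis+
qed

theorem theorem4:
  fixes head tail :: "'e::finite \<Rightarrow> 'v::finite"
    and \<gamma> :: "'e \<Rightarrow> real"
    and v :: "'c::finite \<Rightarrow> real^'e"
    and \<omega> :: "real^'v"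
  assumes simple: "simple_graph head tail"
    and conn: "graph_connected head tail UNIV"
    and weights: "\<And>e. \<gamma> e \<noteq> 0"
    and trees: "\<And>e. \<exists>T. spanning_tree head tail T \<and> e \<notin> T"
    and card_c: "CARD('c) + CARD('v) = CARD('e) + 1"
    and basis: "cycle_basis head tail v"
  shows "(\<forall>I. admissible I \<longrightarrow> W_image head tail \<gamma> v \<omega> I \<in> lmeasurable)
    \<and> is_arg_max (\<lambda>I. measure lebesgue (W_image head tail \<gamma> v \<omega> I)) admissible
        (\<lambda>e. if \<gamma> e > 0 then {-pi/2..pi/2} else {pi/2..3*pi/2})
    \<and> is_arg_max (\<lambda>I. measure lebesgue (W_image head tail \<gamma> v \<omega> I)) admissible
        (\<lambda>e. if \<gamma> e > 0 then {pi/2..3*pi/2} else {-pi/2..pi/2})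
    \<and> ((\<forall>e. \<gamma> e > 0) \<longrightarrow>
        is_arg_max (\<lambda>I. measure lebesgue (W_image head tail \<gamma> v \<omega> I)) admissible
          (\<lambda>e. {-pi/2..pi/2})
      \<and> is_arg_max (\<lambda>I. measure lebesgue (W_image head tail \<gamma> v \<omega> I)) admissible
          (\<lambda>e. {pi/2..3*pi/2}))"
proof -
  let ?W = "W_image head tail \<gamma> v \<omega>"
  have max: "is_arg_max (\<lambda>I. measure lebesgue (?W I)) admissible (half_turns P)"
    if "P = (\<lambda>e. \<gamma> e > 0) \<or> P = (\<lambda>e. \<not> \<gamma> e > 0)" for P
    unfolding is_arg_max_def
  proof (intro conjI notI)
    show "admissible (half_turns P)" by (rule admissible_half_turns)
    assume "\<exists>I. admissible I \<and> measure lebesgue (?W (half_turns P)) < measure lebesgue (?W I)"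
    then obtain I where "admissible I" "measure lebesgue (?W (half_turns P)) < measure lebesgue (?W I)"
      by blast
    then show False
      using W_image_le(2)[OF weights that, of I head tail v \<omega>] by linarith
  qed
  have measurable: "?W I \<in> lmeasurable" if "admissible I" for I
    by (rule W_image_le(1)[OF weights disjI1[OF refl] that])
  have positive: "is_arg_max (\<lambda>I. measure lebesgue (?W I)) admissible (half_turns (\<lambda>e. \<gamma> e > 0))"
    by (rule max) simp
  \<comment> \<open>Negating the predicate swaps the two intervals, which gives the second
    maximizer.\<close>
  have "half_turns (\<lambda>e. \<not> \<gamma> e > 0) = (\<lambda>e. if \<gamma> e > 0 then {pi/2..3*pi/2} else {-pi/2..pi/2})"
    by (rule ext) simp
  with max[of "\<lambda>e. \<not> \<gamma> e > 0"]
  have negative: "is_arg_max (\<lambda>I. measure lebesgue (?W I)) admissible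
      (\<lambda>e. if \<gamma> e > 0 then {pi/2..3*pi/2} else {-pi/2..pi/2})"
    by simp
  show ?thesis
  proof (intro conjI impI allI)
    show "is_arg_max (\<lambda>I. measure lebesgue (?W I)) admissible (\<lambda>e. {-pi/2..pi/2})"
      "is_arg_max (\<lambda>I. measure lebesgue (?W I)) admissible (\<lambda>e. {pi/2..3*pi/2})"
      if "\<forall>e. \<gamma> e > 0"
      using positive negative that by simp_all
  qed (fact measurable positive negative)+
qed

end
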